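(* Let $G_1$ and $G_2$ be finite groups. Then the table of marks of $G_1\times G_2$ is $$M(G_1\times G_2)=D\cdot\mathbf{A}(\leq_K)\cdot\mathbf{A}(\leq_{P/K})\cdot\mathbf{A}(\leq_P),$$ where $D$ is the diagonal matrix with entries $|N_{G_1\times G_2}(L):L|$, for $L$ running over a transversal of the conjugacy classes of subgroups of $G_1\times G_2$, and $\mathbf{A}(\leq_K)$, $\mathbf{A}(\leq_{P/K})$, $\mathbf{A}(\leq_P)$ are the class incidence matrices of the partial orders $\leq_K$, $\leq_{P/K}$, $\leq_P$ on the set of subgroups of $G_1\times G_2$ under conjugation by $G_1\times G_2$.
   Context: Table of marks: for a finite group $G$ with transversal $(H_1,\dots,H_r)$ of the conjugacy classes of subgroups, $M(G)$ is the $r\times r$ matrix whose $(i,j)$ entry is the number $|(G/H_i)^{H_j}|$ of fixed points of $H_j$ on the transitive $G$-set $G/H_i$. A section of a group $G$ is a pair $(P,K)$ of subgroups with $K\trianglelefteq P$. By Goursat's Lemma, subgroups $L$ of $G_1\times G_2$ correspond bijectively to isomorphisms $\theta\colon P_1/K_1\to P_2/K_2$ with $(P_i,K_i)$ a section of $G_i$, where $L=\{(a_1,a_2)\in P_1\times P_2 : \theta(a_1K_1)=a_2K_2\}$; we write $L=(\theta\colon P_1/K_1\to P_2/K_2)$. Here $P_i$ is the projection of $L$ to $G_i$ and $K_1=\{a_1:(a_1,1)\in L\}$, $K_2=\{a_2:(1,a_2)\in L\}$. For subgroups $L=(\theta\colon P_1/K_1\to P_2/K_2)$ and $L'=(\theta'\colon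 P_1'/K_1'\to P_2'/K_2')$ of $G_1\times G_2$ with $L'\leq L$ one has $P_i'\leq P_i$ and $K_i'\leq K_i$, $i=1,2$, and one writes: $L'\leq_P L$ if $P_i'=P_i$ for $i=1,2$; $L'\leq_K L$ if $K_i'=K_i$ for $i=1,2$; $L'\leq_{P/K}L$ if the canonical homomorphisms $P_i'/K_i'\to P_i/K_i$, $pK_i'\mapsto pK_i$, are isomorphisms for $i=1,2$. (The subscripts $P$, $K$, $P/K$ are just names of the relations.) Class incidence matrix: if a finite group $G$ acts on a finite poset $(X,\preceq)$ preserving the order, and $T\subseteq X$ is a transversal of the $G$-orbits, then $\mathbf{A}(\preceq)=(\mathbf{a}_{xy})_{x,y\in T}$ with $\mathbf{a}_{xy}=\#\{x'\in X : x'\text{ in the }G\text{-orbit of }x,\ y\preceq x'\}$. All matrices in the theorem are taken with respect to the same transversal of the conjugacy classes of subgroups of $G_1\times G_2$, in the same order. *)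

theory Defs
  imports "HOL-Algebra.Group_Action" "HOL-Algebra.Left_Coset" "Jordan_Normal_Form.Matrix"
begin

(* A transversal is a list, so that it also fixes the order of rows and columns. *)
definition orbit_transversal ::
    "('g, 'm) monoid_scheme \<Rightarrow> 'x set \<Rightarrow> ('g \<Rightarrow> 'x \<Rightarrow> 'x) \<Rightarrow> 'x list \<Rightarrow> bool" where
  "orbit_transversal G X \<phi> T \<longleftrightarrow>
     distinct T \<and> set T \<subseteq> X \<and> (\<forall>C \<in> orbits G X \<phi>. \<exists>!x. x \<in> set T \<and> x \<in> C)"

definition class_incidence_matrix ::
    "('g, 'm) monoid_scheme \<Rightarrow> 'x set \<Rightarrow> ('g \<Rightarrow> 'x \<Rightarrow> 'x) \<Rightarrow> ('x \<Rightarrow> 'x \<Rightarrow> bool) \<Rightarrow> 'x list \<Rightarrow> nat mat" where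
  "class_incidence_matrix G X \<phi> leq T =
     mat (length T) (length T) (\<lambda>(i, j). card {x' \<in> X. x' \<in> orbit G \<phi> (T ! i) \<and> leq (T ! j) x'})"

definition subgroups_of :: "('g, 'm) monoid_scheme \<Rightarrow> 'g set set" where
  "subgroups_of G = {H. subgroup H G}"

(* The restricted abstraction is what the locale group_action requires; compare
   group.action_by_conjugation_on_subgroups_set. *)
definition subgroup_conj :: "('g, 'm) monoid_scheme \<Rightarrow> 'g \<Rightarrow> 'g set \<Rightarrow> 'g set" where
  "subgroup_conj G = (\<lambda>g. \<lambda>H \<in> subgroups_of G. g <#\<^bsub>G\<^esub> H #>\<^bsub>G\<^esub> (inv\<^bsub>G\<^esub> g))"

definition fixed_points :: "'x set \<Rightarrow> ('g \<Rightarrow> 'x \<Rightarrow> 'x) \<Rightarrow> 'g set \<Rightarrow> 'x set" where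
  "fixed_points X \<phi> H = {x \<in> X. \<forall>h \<in> H. x \<in> invariants X \<phi> h}"

definition coset_action :: "('g, 'm) monoid_scheme \<Rightarrow> 'g set \<Rightarrow> 'g \<Rightarrow> 'g set \<Rightarrow> 'g set" where
  "coset_action G H = (\<lambda>g. \<lambda>C \<in> lcosets\<^bsub>G\<^esub> H. g <#\<^bsub>G\<^esub> C)"

definition table_of_marks :: "('g, 'm) monoid_scheme \<Rightarrow> 'g set list \<Rightarrow> nat mat" where
  "table_of_marks G Hs =
     mat (length Hs) (length Hs)
       (\<lambda>(i, j). card (fixed_points (lcosets\<^bsub>G\<^esub> (Hs ! i)) (coset_action G (Hs ! i)) (Hs ! j)))"

definition subgroup_index :: "('g, 'm) monoid_scheme \<Rightarrow> 'g set \<Rightarrow> 'g set \<Rightarrow> nat" where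
  "subgroup_index G N H = card (lcosets\<^bsub>G\<lparr>carrier := N\<rparr>\<^esub> H)"

(* The Goursat sections (P1, K1) and (P2, K2) of a subgroup L of G1 \<times>\<times> G2 *)
definition goursat_P1 :: "('a \<times> 'b) set \<Rightarrow> 'a set" where
  "goursat_P1 L = fst ` L"

definition goursat_P2 :: "('a \<times> 'b) set \<Rightarrow> 'b set" where
  "goursat_P2 L = snd ` L"

definition goursat_K1 :: "('b, 'n) monoid_scheme \<Rightarrow> ('a \<times> 'b) set \<Rightarrow> 'a set" where
  "goursat_K1 G2 L = {a. (a, \<one>\<^bsub>G2\<^esub>) \<in> L}"

definition goursat_K2 :: "('a, 'm) monoid_scheme \<Rightarrow> ('a \<times> 'b) set \<Rightarrow> 'b set" where
  "goursat_K2 G1 L = {b. (\<one>\<^bsub>G1\<^esub>, b) \<in> L}"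

(* For sections (P', K') and (P, K) of G with P' \<subseteq> P and K' \<subseteq> K: the canonical
   homomorphism P'/K' \<rightarrow> P/K, p K' \<mapsto> p K, is an isomorphism. The quotient Mod
   consists of right cosets, which are the left cosets because K' and K are normal. *)
definition canonical_hom_is_iso ::
    "('g, 'm) monoid_scheme \<Rightarrow> 'g set \<Rightarrow> 'g set \<Rightarrow> 'g set \<Rightarrow> 'g set \<Rightarrow> bool" where
  "canonical_hom_is_iso G P' K' P K \<longleftrightarrow>
     (\<exists>f \<in> iso (G\<lparr>carrier := P'\<rparr> Mod K') (G\<lparr>carrier := P\<rparr> Mod K).
        \<forall>p \<in> P'. f (K' #>\<^bsub>G\<^esub> p) = K #>\<^bsub>G\<^esub> p)"

(* In the relations below the smaller subgroup L' is the first argument. *)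
definition le_P :: "('a \<times> 'b) set \<Rightarrow> ('a \<times> 'b) set \<Rightarrow> bool" where
  "le_P L' L \<longleftrightarrow> L' \<subseteq> L \<and> goursat_P1 L' = goursat_P1 L \<and> goursat_P2 L' = goursat_P2 L"

definition le_K ::
    "('a, 'm) monoid_scheme \<Rightarrow> ('b, 'n) monoid_scheme \<Rightarrow> ('a \<times> 'b) set \<Rightarrow> ('a \<times> 'b) set \<Rightarrow> bool" where
  "le_K G1 G2 L' L \<longleftrightarrow>
     L' \<subseteq> L \<and> goursat_K1 G2 L' = goursat_K1 G2 L \<and> goursat_K2 G1 L' = goursat_K2 G1 L"

definition le_PK ::
    "('a, 'm) monoid_scheme \<Rightarrow> ('b, 'n) monoid_scheme \<Rightarrow> ('a \<times> 'b) set \<Rightarrow> ('a \<times> 'b) set \<Rightarrow> bool" where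
  "le_PK G1 G2 L' L \<longleftrightarrow>
     L' \<subseteq> L \<and>
     canonical_hom_is_iso G1 (goursat_P1 L') (goursat_K1 G2 L') (goursat_P1 L) (goursat_K1 G2 L) \<and>
     canonical_hom_is_iso G2 (goursat_P2 L') (goursat_K2 G1 L') (goursat_P2 L) (goursat_K2 G1 L)"

definition subgroup_class_incidence ::
    "('g, 'm) monoid_scheme \<Rightarrow> ('g set \<Rightarrow> 'g set \<Rightarrow> bool) \<Rightarrow> 'g set list \<Rightarrow> nat mat" where
  "subgroup_class_incidence G leq T =
     class_incidence_matrix G (subgroups_of G) (subgroup_conj G) leq T"

definition normalizer_index_matrix :: "('g, 'm) monoid_scheme \<Rightarrow> 'g set list \<Rightarrow> nat mat" where
  "normalizer_index_matrix G T =
     mat_diag (length T) (\<lambda>i. subgroup_index G (normalizer G (T ! i)) (T ! i))"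

end

theory Submission
  imports Defs "HOL-Algebra.Zassenhaus"
begin

text \<open>
  Counting fixed points of a coset action gives \<open>M(G) = D \<cdot> A(\<subseteq>)\<close>: the coset \<open>xH\<close> is fixed by
  \<open>K\<close> iff \<open>K \<subseteq> xHx\<^sup>-\<^sup>1\<close>, and each conjugate of \<open>H\<close> arises from \<open>|N(H) : H|\<close> cosets.
  The product of class incidence matrices of invariant relations counts chains between a fixed
  subgroup and the conjugates of another. An inclusion \<open>L' \<subseteq> L\<close> of
  subgroups of \<open>G1 \<times>\<times> G2\<close> is refined by exactly one chain \<open>L' \<le>\<^sub>P Z \<le>\<^sub>P\<^sub>/\<^sub>K Y \<le>\<^sub>K L\<close>, namely
  \<open>Z = L \<inter> (P1' \<times> P2')\<close> and \<open>Y = (K1 \<times> K2) L'\<close>: by the second isomorphism theorem the middle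
  relation holds iff \<open>P\<^sub>i(Z) \<inter> K\<^sub>i(Y) = K\<^sub>i(Z)\<close> and \<open>P\<^sub>i(Y) = K\<^sub>i(Y) P\<^sub>i(Z)\<close>.
\<close>

section \<open>Incidence matrices of group actions\<close>

text \<open>Natural-number weights in place of relations make the matrices closed under products.\<close>
definition weighted_incidence ::
    "('g, 'm) monoid_scheme \<Rightarrow> ('g \<Rightarrow> 'x \<Rightarrow> 'x) \<Rightarrow> ('x \<Rightarrow> 'x \<Rightarrow> nat) \<Rightarrow> 'x list \<Rightarrow> nat mat" where
  "weighted_incidence G \<phi> w T =
     mat (length T) (length T) (\<lambda>(i, j). \<Sum>x \<in> orbit G \<phi> (T ! i). w (T ! j) x)"

lemma weighted_incidence_carrier [simp]:
  "weighted_incidence G \<phi> w T \<in> carrier_mat (length T) (length T)"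
  by (simp add: weighted_incidence_def)

lemma (in group_action) orbit_subset: "x \<in> E \<Longrightarrow> orbit G \<phi> x \<subseteq> E"
  unfolding orbit_def using element_image by auto

text \<open>This converts the inner index of a matrix product into a sum over orbits: each orbit
  contains exactly one entry of \<open>T\<close>, and \<open>distinct T\<close> makes the position
  of that entry unique.\<close>

lemma (in group_action) transversal_bij_betw_orbits:
  assumes "orbit_transversal G E \<phi> T"
  shows "bij_betw (\<lambda>k. orbit G \<phi> (T ! k)) {..<length T} (orbits G E \<phi>)"
proof (rule bij_betw_imageI)
  have T: "distinct T" "set T \<subseteq> E" and ex1: "\<And>C. C \<in> orbits G E \<phi> \<Longrightarrow> \<exists>!x. x \<in> set T \<and> x \<in> C"
    using assms by (auto simp: orbit_transversal_def)
  have orbs: "orbit G \<phi> x \<in> orbits G E \<phi>" if "x \<in> set T" for x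
    using that T by (auto simp: orbits_def)
  show "inj_on (\<lambda>k. orbit G \<phi> (T ! k)) {..<length T}"
  proof (rule inj_onI)
    fix k l assume kl: "k \<in> {..<length T}" "l \<in> {..<length T}"
      and eq: "orbit G \<phi> (T ! k) = orbit G \<phi> (T ! l)"
    then have "T ! k \<in> set T" "T ! l \<in> set T" by auto
    moreover from this have "T ! k \<in> orbit G \<phi> (T ! k)" "T ! l \<in> orbit G \<phi> (T ! k)"
      using T(2) eq orbit_refl by auto
    ultimately have "T ! k = T ! l" using ex1[OF orbs] by blast
    then show "k = l" using kl T(1) by (simp add: nth_eq_iff_index_eq)
  qed
  show "(\<lambda>k. orbit G \<phi> (T ! k)) ` {..<length T} = orbits G E \<phi>"
  proof (intro equalityI subsetI)
    fix C assume C: "C \<in> orbits G E \<phi>"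
    then obtain x where x: "x \<in> set T" "x \<in> C" using ex1 by blast
    have "orbit G \<phi> x = C"
      using disjoint_union[OF C orbs[OF x(1)]] x T(2) orbit_refl by blast
    with x(1) show "C \<in> (\<lambda>k. orbit G \<phi> (T ! k)) ` {..<length T}"
      by (auto simp: in_set_conv_nth)
  qed (auto intro: orbs)
qed

text \<open>Permits reindexing a sum over an orbit by \<open>\<phi> g\<close>. Closure of the orbit
  is the action law; the preimage of \<open>y\<close> is \<open>\<phi> (inv g) y\<close>, which
  closure for \<open>inv g\<close> keeps in the orbit.\<close>

lemma (in group_action) bij_betw_orbit:
  assumes "x \<in> E" "g \<in> carrier G"
  shows "bij_betw (\<phi> g) (orbit G \<phi> x) (orbit G \<phi> x)"
proof (rule bij_betw_imageI)
  interpret G: group G using group_hom by (rule group_hom.axioms)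
  have sub: "\<phi> h ` orbit G \<phi> x \<subseteq> orbit G \<phi> x" if "h \<in> carrier G" for h
    using that assms(1) by (auto simp: orbit_def simp flip: composition_rule intro: G.m_closed)
  show "inj_on (\<phi> g) (orbit G \<phi> x)"
    by (rule inj_on_subset[OF inj_prop[OF assms(2)] orbit_subset[OF assms(1)]])
  show "\<phi> g ` orbit G \<phi> x = orbit G \<phi> x"
  proof
    show "orbit G \<phi> x \<subseteq> \<phi> g ` orbit G \<phi> x"
    proof
      fix y assume y: "y \<in> orbit G \<phi> x"
      then have "y \<in> E" using assms(1) orbit_subset by blast
      then have "y = \<phi> g (\<phi> (inv g) y)"
        using orbit_sym_aux[of "inv g" y] assms(2) by simp
      moreover have "\<phi> (inv g) y \<in> orbit G \<phi> x" using sub[of "inv g"] y assms(2) by auto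
      ultimately show "y \<in> \<phi> g ` orbit G \<phi> x" by blast
    qed
  qed (rule sub[OF assms(2)])
qed

text \<open>The missing direction is the assumed implication at \<open>inv g\<close>. One-sided
  preservation thus suffices for equality of the 0/1 weights attached to a relation.\<close>

lemma (in group_action) invariant_relation_iff:
  assumes "\<And>g x y. g \<in> carrier G \<Longrightarrow> x \<in> E \<Longrightarrow> y \<in> E \<Longrightarrow> R x y \<Longrightarrow> R (\<phi> g x) (\<phi> g y)"
    and "g \<in> carrier G" "x \<in> E" "y \<in> E"
  shows "R (\<phi> g x) (\<phi> g y) \<longleftrightarrow> R x y"
proof
  interpret G: group G using group_hom by (rule group_hom.axioms)
  assume "R (\<phi> g x) (\<phi> g y)"
  then have "R (\<phi> (inv g) (\<phi> g x)) (\<phi> (inv g) (\<phi> g y))"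
    using assms(1)[of "inv g" "\<phi> g x" "\<phi> g y"] assms(2-4) element_image by auto
  then show "R x y"
    using orbit_sym_aux[OF assms(2,3) refl] orbit_sym_aux[OF assms(2,4) refl] by simp
qed (use assms in blast)

text \<open>By invariance the sum of \<open>v y\<close> over the orbit of \<open>T ! i\<close> is
  the same for all \<open>y\<close> in one orbit, so the representative \<open>T ! k\<close> may be
  replaced by every \<open>y\<close> that it represents, and \<open>k\<close> and \<open>y\<close>
  together run once through \<open>E\<close>. Since the column index carries the smaller element,
  the right factor \<open>w\<close> is the lower step of a chain.\<close>

lemma (in group_action) weighted_incidence_mult:
  assumes T: "orbit_transversal G E \<phi> T" and "finite E"
    and inv: "\<And>g x y. g \<in> carrier G \<Longrightarrow> x \<in> E \<Longrightarrow> y \<in> E \<Longrightarrow> v (\<phi> g x) (\<phi> g y) = v x y"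
  shows "weighted_incidence G \<phi> v T * weighted_incidence G \<phi> w T =
    weighted_incidence G \<phi> (\<lambda>x z. \<Sum>y\<in>E. w x y * v y z) T" (is "?L = ?R")
proof (rule eq_matI)
  have TE: "T ! k \<in> E" if "k < length T" for k
    using T that nth_mem by (fastforce simp: orbit_transversal_def)
  fix i j assume "i < dim_row ?R" "j < dim_col ?R"
  then have i: "i < length T" and j: "j < length T" by (auto simp: weighted_incidence_def)
  let ?O = "\<lambda>k. orbit G \<phi> (T ! k)"
  have const: "(\<Sum>z\<in>?O i. v y z) = (\<Sum>z\<in>?O i. v (T ! k) z)" if "k < length T" "y \<in> ?O k" for k y
  proof -
    from that(2) obtain g where g: "g \<in> carrier G" "y = \<phi> g (T ! k)" by (auto simp: orbit_def)
    have "(\<Sum>z\<in>?O i. v (T ! k) z) = (\<Sum>z\<in>?O i. v y (\<phi> g z))"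
      using inv g TE[OF that(1)] orbit_subset[OF TE[OF i]] by (intro sum.cong) auto
    also have "\<dots> = (\<Sum>z\<in>?O i. v y z)"
      by (rule sum.reindex_bij_betw[OF bij_betw_orbit[OF TE[OF i] g(1)]])
    finally show ?thesis by simp
  qed
  \<comment> \<open>The left factor sees only the representative \<open>T ! k\<close>, whereas the
    right factor already sums over its whole orbit.\<close>
  have "?L $$ (i, j) = (\<Sum>k<length T. (\<Sum>z\<in>?O i. v (T ! k) z) * (\<Sum>y\<in>?O k. w (T ! j) y))"
    using i j by (simp add: weighted_incidence_def scalar_prod_def atLeast0LessThan)
  also have "\<dots> = (\<Sum>k<length T. \<Sum>y\<in>?O k. w (T ! j) y * (\<Sum>z\<in>?O i. v y z))"
    using const by (intro sum.cong) (auto simp: sum_distrib_left mult.commute)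
  also have "\<dots> = (\<Sum>C\<in>orbits G E \<phi>. \<Sum>y\<in>C. w (T ! j) y * (\<Sum>z\<in>?O i. v y z))"
    by (rule sum.reindex_bij_betw[OF transversal_bij_betw_orbits[OF T]])
  also have "\<dots> = (\<Sum>y\<in>E. w (T ! j) y * (\<Sum>z\<in>?O i. v y z))"
    by (rule disjoint_sum[OF \<open>finite E\<close>])
  also have "\<dots> = (\<Sum>z\<in>?O i. \<Sum>y\<in>E. w (T ! j) y * v y z)"
    unfolding sum_distrib_left by (rule sum.swap)
  finally show "?L $$ (i, j) = ?R $$ (i, j)"
    using i j by (simp add: weighted_incidence_def)
qed (auto simp: weighted_incidence_def)

lemma (in group_action) class_incidence_matrix_eq_weighted:
  assumes "orbit_transversal G E \<phi> T" and "finite E"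
  shows "class_incidence_matrix G E \<phi> leq T =
    weighted_incidence G \<phi> (\<lambda>x y. of_bool (leq x y)) T"
proof -
  have "card {y \<in> E. y \<in> orbit G \<phi> (T ! i) \<and> leq (T ! j) y} =
      (\<Sum>y\<in>orbit G \<phi> (T ! i). of_bool (leq (T ! j) y))" if "i < length T" for i j
  proof -
    have "T ! i \<in> E" using assms(1) that nth_mem by (fastforce simp: orbit_transversal_def)
    then have sub: "orbit G \<phi> (T ! i) \<subseteq> E" by (rule orbit_subset)
    then have "{y \<in> E. y \<in> orbit G \<phi> (T ! i) \<and> leq (T ! j) y} =
        orbit G \<phi> (T ! i) \<inter> {y. leq (T ! j) y}" by auto
    then show ?thesis
      using finite_subset[OF sub assms(2)] by (simp add: sum_of_bool_eq)
  qed
  then show ?thesis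
    by (auto simp: class_incidence_matrix_def weighted_incidence_def intro!: cong_mat)
qed

section \<open>Marks\<close>

lemma (in group) subgroup_conj_action:
  "group_action G (subgroups_of G) (subgroup_conj G)"
  using action_by_conjugation_on_subgroups_set
  by (simp add: subgroups_of_def subgroup_conj_def)

lemma (in group) mem_conjugate_iff:
  assumes "g \<in> carrier G" "a \<in> carrier G" "H \<subseteq> carrier G"
  shows "a \<in> g <# H #> inv g \<longleftrightarrow> inv g \<otimes> a \<otimes> g \<in> H"
proof
  assume "a \<in> g <# H #> inv g"
  then obtain h where h: "h \<in> H" "a = g \<otimes> h \<otimes> inv g"
    by (auto simp: l_coset_def r_coset_def)
  then have "h \<in> carrier G" using assms by auto
  then have "inv g \<otimes> a \<otimes> g = h"
    using assms h conjugation_is_surj[of "inv g" h] by simp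
  then show "inv g \<otimes> a \<otimes> g \<in> H" using h by simp
next
  assume "inv g \<otimes> a \<otimes> g \<in> H"
  then have "g \<otimes> (inv g \<otimes> a \<otimes> g) \<otimes> inv g \<in> g <# H #> inv g"
    by (auto simp: l_coset_def r_coset_def)
  then show "a \<in> g <# H #> inv g" using assms by (simp add: conjugation_is_surj)
qed

text \<open>An element \<open>a\<close> fixes the coset of \<open>g\<close> iff
  \<open>a \<otimes> g\<close> lies in \<open>g <# H\<close>, that is, iff
  \<open>inv g \<otimes> a \<otimes> g\<close> lies in \<open>H\<close>. Being fixed by a subgroup
  thereby becomes inclusion of that subgroup in a conjugate of \<open>H\<close>.\<close>

lemma (in group) conjugate_eq_coset_stabilizer:
  assumes "subgroup H G" "g \<in> carrier G"
  shows "g <# H #> inv g = {a \<in> carrier G. a <# (g <# H) = g <# H}"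
proof -
  interpret H: subgroup H G by fact
  have "a <# (g <# H) = g <# H \<longleftrightarrow> inv g \<otimes> a \<otimes> g \<in> H" if "a \<in> carrier G" for a
  proof -
    have "a <# (g <# H) = a \<otimes> g <# H"
      using that assms H.subset by (simp add: lcos_m_assoc)
    moreover have "a \<otimes> g <# H = g <# H \<longleftrightarrow> a \<otimes> g \<in> g <# H"
      using that assms l_repr_independence[OF _ assms(2,1)] lcos_self[of "a \<otimes> g" H] by auto
    moreover have "a \<otimes> g \<in> g <# H \<longleftrightarrow> inv g \<otimes> (a \<otimes> g) \<in> H"
      using that assms H.lcos_module_imp[OF is_group, of g "a \<otimes> g"]
        H.lcos_module_rev[OF is_group, of g "a \<otimes> g"] by auto
    ultimately show ?thesis using that assms by (simp add: m_assoc)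
  qed
  moreover have "g <# H #> inv g \<subseteq> carrier G"
    using subgroup_conjugation_is_surj2[OF assms(2,1)] by (rule subgroup.subset)
  ultimately show ?thesis using mem_conjugate_iff[OF assms(2) _ H.subset] by blast
qed

text \<open>By the action law the left side is \<open>g\<close> applied to the conjugate of
  \<open>H\<close> by \<open>x\<close>. The action of \<open>g\<close> is injective and cancels,
  leaving that \<open>x\<close> stabilizes \<open>H\<close>.\<close>

lemma (in group) conjugate_mult_eq_iff:
  assumes "subgroup H G" "g \<in> carrier G" "x \<in> carrier G"
  shows "(g \<otimes> x) <# H #> inv (g \<otimes> x) = g <# H #> inv g \<longleftrightarrow> x \<in> normalizer G H"
proof -
  interpret conj: group_action G "subgroups_of G" "subgroup_conj G"
    by (rule subgroup_conj_action)
  have H: "H \<in> subgroups_of G" using assms(1) by (simp add: subgroups_of_def)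
  have eq: "y <# H #> inv y = subgroup_conj G y H" for y
    using H by (simp add: subgroup_conj_def)
  have "subgroup_conj G (g \<otimes> x) H = subgroup_conj G g H \<longleftrightarrow> subgroup_conj G x H = H"
    using conj.composition_rule[OF H assms(2,3)] conj.element_image[OF assms(3) H refl]
      conj.inj_prop[OF assms(2)] H by (auto dest: inj_onD)
  moreover have "x \<in> normalizer G H \<longleftrightarrow> subgroup_conj G x H = H"
    using assms H subgroup.subset[OF assms(1)]
    by (simp add: normalizer_def stabilizer_def subgroup_conj_def)
  ultimately show ?thesis unfolding eq by simp
qed

lemma (in group) inj_on_l_coset: "g \<in> carrier G \<Longrightarrow> inj_on (\<lambda>C. g <# C) (Pow (carrier G))"
proof (rule inj_on_inverseI)
  fix C assume "g \<in> carrier G" "C \<in> Pow (carrier G)"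
  then show "inv g <# (g <# C) = C" by (simp add: lcos_m_assoc lcos_mult_one)
qed

lemma (in group) lcosets_normalizer:
  "lcosets\<^bsub>G\<lparr>carrier := normalizer G H\<rparr>\<^esub> H = (\<lambda>x. x <# H) ` normalizer G H"
  by (auto simp: LCOSETS_def)

text \<open>The stabilizer of \<open>y <# H\<close> is the conjugate of \<open>H\<close> by
  \<open>y\<close>, and it equals the conjugate by \<open>g\<close> exactly when
  \<open>y = g \<otimes> x\<close> with \<open>x\<close> in the normalizer. The cosets counted are
  thus the translates by \<open>g\<close> of the cosets of \<open>H\<close> in its normalizer, and
  translation is injective.\<close>

lemma (in group) card_lcosets_with_stabilizer:
  assumes H: "subgroup H G" and g: "g \<in> carrier G"
  shows "card {C \<in> lcosets H. {a \<in> carrier G. a <# C = C} = g <# H #> inv g} =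
    subgroup_index G (normalizer G H) H"
proof -
  let ?N = "normalizer G H"
  have HG: "H \<subseteq> carrier G" using H by (rule subgroup.subset)
  have NG: "?N \<subseteq> carrier G" by (auto simp: normalizer_def stabilizer_def)
  have "{C \<in> lcosets H. {a \<in> carrier G. a <# C = C} = g <# H #> inv g} =
      {y <# H |y. y \<in> carrier G \<and> y <# H #> inv y = g <# H #> inv g}"
    using conjugate_eq_coset_stabilizer[OF H] by (auto simp: LCOSETS_def)
  also have "\<dots> = {(g \<otimes> x) <# H |x. x \<in> ?N}"
  proof -
    have "\<exists>x \<in> ?N. y = g \<otimes> x" if "y \<in> carrier G" "y <# H #> inv y = g <# H #> inv g" for y
      using that g conjugate_mult_eq_iff[OF H g, of "inv g \<otimes> y"]
      by (intro bexI[of _ "inv g \<otimes> y"]) (simp_all flip: m_assoc)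
    moreover have "g \<otimes> x \<in> carrier G \<and>
        (g \<otimes> x) <# H #> inv (g \<otimes> x) = g <# H #> inv g" if "x \<in> ?N" for x
      using that NG g conjugate_mult_eq_iff[OF H g, of x] by auto
    ultimately show ?thesis by blast
  qed
  also have "\<dots> = (\<lambda>C. g <# C) ` (lcosets\<^bsub>G\<lparr>carrier := ?N\<rparr>\<^esub> H)"
    unfolding lcosets_normalizer using lcos_m_assoc[OF HG g] NG by auto
  also have "card \<dots> = card (lcosets\<^bsub>G\<lparr>carrier := ?N\<rparr>\<^esub> H)"
    unfolding lcosets_normalizer
    by (intro card_image inj_on_subset[OF inj_on_l_coset[OF g]])
      (use l_coset_subset_G[OF HG] NG in auto)
  finally show ?thesis by (simp add: subgroup_index_def)
qed

text \<open>The fixed cosets are partitioned by their stabilizers. These are the conjugates of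
  \<open>H\<close> containing \<open>K\<close>, and all fibres have the same size.\<close>

lemma (in group) card_fixed_points_coset_action:
  assumes fin: "finite (carrier G)" and H: "subgroup H G" and K: "subgroup K G"
  shows "card (fixed_points (lcosets H) (coset_action G H) K) =
    subgroup_index G (normalizer G H) H * card {H' \<in> orbit G (subgroup_conj G) H. K \<subseteq> H'}"
proof -
  let ?stab = "\<lambda>C. {a \<in> carrier G. a <# C = C}"
  let ?F = "{C \<in> lcosets H. K \<subseteq> ?stab C}"
  let ?O = "{H' \<in> orbit G (subgroup_conj G) H. K \<subseteq> H'}"
  have orbit: "orbit G (subgroup_conj G) H = (\<lambda>g. g <# H #> inv g) ` carrier G"
    using H by (auto simp: orbit_def subgroup_conj_def subgroups_of_def)
  have finL: "finite (lcosets H)"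
    using fin by (simp add: LCOSETS_def)
  have finO: "finite ?O" using fin by (simp add: orbit)
  have stab: "?stab C \<in> orbit G (subgroup_conj G) H" if "C \<in> lcosets H" for C
    using that conjugate_eq_coset_stabilizer[OF H] by (auto simp: orbit LCOSETS_def)
  have "fixed_points (lcosets H) (coset_action G H) K = ?F"
    using subgroup.subset[OF K]
    by (auto simp: fixed_points_def invariants_def coset_action_def)
  also have "card ?F = card (\<Union>H'\<in>?O. {C \<in> lcosets H. ?stab C = H'})"
    using stab by (intro arg_cong[where f = card]) blast
  also have "\<dots> = (\<Sum>H'\<in>?O. card {C \<in> lcosets H. ?stab C = H'})"
    using finO finL by (intro card_UN_disjoint) auto
  also have "\<dots> = (\<Sum>H'\<in>?O. subgroup_index G (normalizer G H) H)"
    using card_lcosets_with_stabilizer[OF H] by (intro sum.cong) (auto simp: orbit)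
  finally show ?thesis by simp
qed

section \<open>Sections of a direct product\<close>

text \<open>The first inclusion is injectivity, since the coset of \<open>p\<close> becomes trivial
  iff \<open>p \<in> K\<close>; the second is surjectivity. Inclusions of sets are easier to
  transport and to check than the existence of a map.\<close>

lemma (in group) canonical_hom_is_iso_iff:
  assumes P: "subgroup P G" and P': "subgroup P' G" and "P' \<subseteq> P" and "K' \<subseteq> K"
    and K: "K \<lhd> G\<lparr>carrier := P\<rparr>" and K': "K' \<lhd> G\<lparr>carrier := P'\<rparr>"
  shows "canonical_hom_is_iso G P' K' P K \<longleftrightarrow> P' \<inter> K \<subseteq> K' \<and> P \<subseteq> K <#> P'"
proof -
  interpret P: subgroup P G by fact
  interpret P': subgroup P' G by fact
  interpret K: normal K "G\<lparr>carrier := P\<rparr>" by fact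
  interpret K': normal K' "G\<lparr>carrier := P'\<rparr>" by fact
  have KG: "subgroup K G" and KG': "subgroup K' G"
    using incl_subgroup P P' K.subgroup_axioms K'.subgroup_axioms by blast+
  have KC: "K \<subseteq> carrier G" "K' \<subseteq> carrier G"
    using KG KG' by (auto dest: subgroup.subset)
  have coset: "C \<in> carrier (G\<lparr>carrier := P'\<rparr> Mod K') \<longleftrightarrow> (\<exists>p \<in> P'. C = K' #> p)" for C
    by (auto simp: carrier_FactGroup)
  have coset': "C \<in> carrier (G\<lparr>carrier := P\<rparr> Mod K) \<longleftrightarrow> (\<exists>p \<in> P. C = K #> p)" for C
    by (auto simp: carrier_FactGroup)
  have mult: "(K #> p) <#> (K #> q) = K #> (p \<otimes> q)" if "p \<in> P" "q \<in> P" for p q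
    using K.rcos_sum[of p q] that by simp
  have mult': "(K' #> p) <#> (K' #> q) = K' #> (p \<otimes> q)" if "p \<in> P'" "q \<in> P'" for p q
    using K'.rcos_sum[of p q] that by simp
  have eq_iff: "N #> p = N #> q \<longleftrightarrow> p \<otimes> inv q \<in> N"
    if "subgroup N G" "p \<in> carrier G" "q \<in> carrier G" for N p q
  proof
    assume "N #> p = N #> q"
    then have "p \<in> N #> q" using that rcos_self by blast
    then show "p \<otimes> inv q \<in> N" using that subgroup.rcos_module_imp[OF _ is_group] by blast
  next
    assume "p \<otimes> inv q \<in> N"
    then have "p \<in> N #> q" using that subgroup.rcos_module_rev[OF _ is_group] by blast
    then show "N #> p = N #> q" using that repr_independence by simp
  qed
  show ?thesis
  proof
    assume "canonical_hom_is_iso G P' K' P K"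
    then obtain f where f: "f \<in> iso (G\<lparr>carrier := P'\<rparr> Mod K') (G\<lparr>carrier := P\<rparr> Mod K)"
      and can: "\<And>p. p \<in> P' \<Longrightarrow> f (K' #> p) = K #> p"
      by (auto simp: canonical_hom_is_iso_def)
    have inj: "inj_on f (carrier (G\<lparr>carrier := P'\<rparr> Mod K'))"
      and surj: "f ` carrier (G\<lparr>carrier := P'\<rparr> Mod K') = carrier (G\<lparr>carrier := P\<rparr> Mod K)"
      using f by (auto simp: iso_def bij_betw_def)
    have "p \<in> K'" if p: "p \<in> P'" "p \<in> K" for p
    proof -
      have "f (K' #> p) = f (K' #> \<one>)"
        using p eq_iff[OF KG, of p \<one>] can[OF p(1)] can[OF P'.one_closed] by simp
      then have "K' #> p = K' #> \<one>"
        by (rule inj_onD[OF inj]) (use p(1) P'.one_closed in \<open>auto simp only: coset\<close>)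
      then show ?thesis using p eq_iff[OF KG', of p \<one>] by simp
    qed
    moreover have "p \<in> K <#> P'" if p: "p \<in> P" for p
    proof -
      have "K #> p \<in> f ` carrier (G\<lparr>carrier := P'\<rparr> Mod K')"
        unfolding surj coset' using p by blast
      then obtain C where C: "C \<in> carrier (G\<lparr>carrier := P'\<rparr> Mod K')" "K #> p = f C"
        by blast
      then obtain q where q: "q \<in> P'" "K #> p = K #> q"
        using can unfolding coset by blast
      then have "p \<in> K #> q" using p rcos_self[OF _ KG, of p] by auto
      with q show ?thesis by (auto simp: r_coset_def set_mult_def)
    qed
    ultimately show "P' \<inter> K \<subseteq> K' \<and> P \<subseteq> K <#> P'" by blast
  next
    assume *: "P' \<inter> K \<subseteq> K' \<and> P \<subseteq> K <#> P'"
    \<comment> \<open>Because \<open>K'\<close> is absorbed by \<open>K\<close>, the map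
      \<open>\<lambda>C. K <#> C\<close> sends the coset of \<open>p\<close> modulo
      \<open>K'\<close> to its coset modulo \<open>K\<close>. It realizes the canonical homomorphism
      without choosing representatives.\<close>
    have "K <#> K' = K"
    proof
      show "K <#> K' \<subseteq> K"
        using \<open>K' \<subseteq> K\<close> subgroup.m_closed[OF KG] by (auto simp: set_mult_def)
      show "K \<subseteq> K <#> K'"
      proof
        fix k assume "k \<in> K"
        then have "k = k \<otimes> \<one>" "k \<in> K" using KC by auto
        then show "k \<in> K <#> K'"
          using subgroup.one_closed[OF KG'] unfolding set_mult_def by blast
      qed
    qed
    then have can: "K <#> (K' #> p) = K #> p" if "p \<in> P'" for p
      using that setmult_rcos_assoc[OF KC, of p] by simp
    let ?f = "\<lambda>C. K <#> C"
    have "?f \<in> hom (G\<lparr>carrier := P'\<rparr> Mod K') (G\<lparr>carrier := P\<rparr> Mod K)"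
    proof (rule homI)
      fix C D assume "C \<in> carrier (G\<lparr>carrier := P'\<rparr> Mod K')" "D \<in> carrier (G\<lparr>carrier := P'\<rparr> Mod K')"
      then obtain p q where "p \<in> P'" "C = K' #> p" "q \<in> P'" "D = K' #> q"
        unfolding coset by blast
      then show "?f (C \<otimes>\<^bsub>G\<lparr>carrier := P'\<rparr> Mod K'\<^esub> D) = ?f C \<otimes>\<^bsub>G\<lparr>carrier := P\<rparr> Mod K\<^esub> ?f D"
        using \<open>P' \<subseteq> P\<close> by (simp add: can mult mult' subset_iff)
    qed (use can \<open>P' \<subseteq> P\<close> in \<open>force simp: coset coset'\<close>)
    moreover have "bij_betw ?f (carrier (G\<lparr>carrier := P'\<rparr> Mod K')) (carrier (G\<lparr>carrier := P\<rparr> Mod K))"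
    proof (rule bij_betw_imageI)
      show "inj_on ?f (carrier (G\<lparr>carrier := P'\<rparr> Mod K'))"
      proof (rule inj_onI)
        fix C D assume "C \<in> carrier (G\<lparr>carrier := P'\<rparr> Mod K')" "D \<in> carrier (G\<lparr>carrier := P'\<rparr> Mod K')"
          and fCD: "?f C = ?f D"
        then obtain p q where pq: "p \<in> P'" "C = K' #> p" "q \<in> P'" "D = K' #> q"
          unfolding coset by blast
        then have "p \<otimes> inv q \<in> P' \<inter> K"
          using fCD can[OF pq(1)] can[OF pq(3)] eq_iff[OF KG, of p q] by simp
        then have "p \<otimes> inv q \<in> K'" using * by blast
        then show "C = D" using pq eq_iff[OF KG', of p q] by simp
      qed
      show "?f ` carrier (G\<lparr>carrier := P'\<rparr> Mod K') = carrier (G\<lparr>carrier := P\<rparr> Mod K)"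
      proof (intro equalityI subsetI)
        fix C assume "C \<in> carrier (G\<lparr>carrier := P\<rparr> Mod K)"
        then obtain p where p: "p \<in> P" "C = K #> p" unfolding coset' by blast
        then obtain k q where kq: "k \<in> K" "q \<in> P'" "p = k \<otimes> q"
          using * by (auto simp: set_mult_def)
        then have "p \<otimes> inv q = k" using KC(1) P'.mem_carrier by (auto simp: m_assoc)
        then have "C = ?f (K' #> q)"
          using p kq can[OF kq(2)] eq_iff[OF KG, of p q] by simp
        moreover have "K' #> q \<in> carrier (G\<lparr>carrier := P'\<rparr> Mod K')"
          unfolding coset using kq(2) by blast
        ultimately show "C \<in> ?f ` carrier (G\<lparr>carrier := P'\<rparr> Mod K')" by blast
      qed (use can \<open>P' \<subseteq> P\<close> in \<open>force simp: coset coset'\<close>)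
    qed
    ultimately show "canonical_hom_is_iso G P' K' P K"
      unfolding canonical_hom_is_iso_def using can
      by (intro bexI[of _ ?f]) (auto simp: iso_def)
  qed
qed

text \<open>Interpreting this locale with the two groups exchanged turns facts about
  \<open>goursat_P1\<close> and \<open>goursat_K1\<close> of the converse relation
  \<open>L\<inverse>\<close> into facts about \<open>goursat_P2\<close> and
  \<open>goursat_K2\<close> of \<open>L\<close>.\<close>

locale group_pair = G1: group G1 + G2: group G2
  for G1 :: "('a, 'm) monoid_scheme" and G2 :: "('b, 'n) monoid_scheme"
begin

lemma group_DirProd: "group (G1 \<times>\<times> G2)"
  by (rule DirProd_group[OF G1.is_group G2.is_group])

context
  fixes L assumes L: "subgroup L (G1 \<times>\<times> G2)"
begin

lemma subgroup_DirProd_closed: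
  shows "(a, b) \<in> L \<Longrightarrow> a \<in> carrier G1" "(a, b) \<in> L \<Longrightarrow> b \<in> carrier G2"
    and "(\<one>\<^bsub>G1\<^esub>, \<one>\<^bsub>G2\<^esub>) \<in> L"
    and "(a, b) \<in> L \<Longrightarrow> (a', b') \<in> L \<Longrightarrow> (a \<otimes>\<^bsub>G1\<^esub> a', b \<otimes>\<^bsub>G2\<^esub> b') \<in> L"
    and "(a, b) \<in> L \<Longrightarrow> (inv\<^bsub>G1\<^esub> a, inv\<^bsub>G2\<^esub> b) \<in> L"
proof -
  show C: "(a, b) \<in> L \<Longrightarrow> a \<in> carrier G1" "(a, b) \<in> L \<Longrightarrow> b \<in> carrier G2" for a b
    using subgroup.subset[OF L] by auto
  show "(\<one>\<^bsub>G1\<^esub>, \<one>\<^bsub>G2\<^esub>) \<in> L" using subgroup.one_closed[OF L] by simp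
  show "(a, b) \<in> L \<Longrightarrow> (a', b') \<in> L \<Longrightarrow> (a \<otimes>\<^bsub>G1\<^esub> a', b \<otimes>\<^bsub>G2\<^esub> b') \<in> L"
    using subgroup.m_closed[OF L, of "(a, b)" "(a', b')"] by simp
  show "(a, b) \<in> L \<Longrightarrow> (inv\<^bsub>G1\<^esub> a, inv\<^bsub>G2\<^esub> b) \<in> L"
    using subgroup.m_inv_closed[OF L, of "(a, b)"] C
    by (simp add: inv_DirProd[OF G1.is_group G2.is_group])
qed

text \<open>Dividing one pair by the other cancels the first coordinate. This is the part of
  Goursat's Lemma by which \<open>a\<close> determines \<open>b\<close> modulo \<open>K2\<close>; it
  stands in for the isomorphism \<open>\<theta>\<close>.\<close>

lemma same_fst_imp_K2:
  assumes "(a, b) \<in> L" "(a, b') \<in> L"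
  shows "b \<otimes>\<^bsub>G2\<^esub> inv\<^bsub>G2\<^esub> b' \<in> goursat_K2 G1 L"
  using subgroup_DirProd_closed(4)[OF assms(1) subgroup_DirProd_closed(5)[OF assms(2)]]
    subgroup_DirProd_closed(1)[OF assms(1)] by (simp add: goursat_K2_def)

lemma subgroup_goursat_P1: "subgroup (goursat_P1 L) G1"
proof -
  have "fst \<in> hom (G1 \<times>\<times> G2) G1" by (auto simp: hom_def mult_DirProd')
  then have "group_hom (G1 \<times>\<times> G2) G1 fst"
    by (intro group_hom.intro group_DirProd G1.is_group group_hom_axioms.intro)
  then show ?thesis
    unfolding goursat_P1_def by (rule group_hom.subgroup_img_is_subgroup[OF _ L])
qed

text \<open>Lift \<open>x\<close> to a pair \<open>(x, b)\<close> in \<open>L\<close>. Conjugating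
  \<open>(h, \<one>)\<close> by this pair leaves the second coordinate trivial.\<close>

lemma goursat_K1_normal: "goursat_K1 G2 L \<lhd> G1\<lparr>carrier := goursat_P1 L\<rparr>"
proof -
  interpret P: group "G1\<lparr>carrier := goursat_P1 L\<rparr>"
    by (rule G1.subgroup_imp_group[OF subgroup_goursat_P1])
  have inv: "inv\<^bsub>G1\<lparr>carrier := goursat_P1 L\<rparr>\<^esub> a = inv\<^bsub>G1\<^esub> a" if "a \<in> goursat_P1 L" for a
    by (rule G1.m_inv_consistent[OF subgroup_goursat_P1 that])
  have sub: "subgroup (goursat_K1 G2 L) G1"
  proof (rule G1.subgroupI)
    show "goursat_K1 G2 L \<subseteq> carrier G1" "goursat_K1 G2 L \<noteq> {}"
      using subgroup_DirProd_closed(1) subgroup_DirProd_closed(3)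
      unfolding goursat_K1_def by blast+
    show "inv\<^bsub>G1\<^esub> a \<in> goursat_K1 G2 L" if "a \<in> goursat_K1 G2 L" for a
      using that subgroup_DirProd_closed(5)[of a "\<one>\<^bsub>G2\<^esub>"] by (simp add: goursat_K1_def)
    show "a \<otimes>\<^bsub>G1\<^esub> b \<in> goursat_K1 G2 L" if "a \<in> goursat_K1 G2 L" "b \<in> goursat_K1 G2 L" for a b
      using that subgroup_DirProd_closed(4)[of a "\<one>\<^bsub>G2\<^esub>" b "\<one>\<^bsub>G2\<^esub>"] by (simp add: goursat_K1_def)
  qed
  have "subgroup (goursat_K1 G2 L) (G1\<lparr>carrier := goursat_P1 L\<rparr>)"
    by (rule G1.subgroup_incl[OF sub subgroup_goursat_P1])
      (force simp: goursat_K1_def goursat_P1_def image_iff)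
  moreover have "x \<otimes>\<^bsub>G1\<^esub> h \<otimes>\<^bsub>G1\<^esub> inv\<^bsub>G1\<^esub> x \<in> goursat_K1 G2 L"
    if "x \<in> goursat_P1 L" "h \<in> goursat_K1 G2 L" for x h
  proof -
    from that(1) obtain b where xb: "(x, b) \<in> L" by (auto simp: goursat_P1_def)
    then have "(x \<otimes>\<^bsub>G1\<^esub> h \<otimes>\<^bsub>G1\<^esub> inv\<^bsub>G1\<^esub> x, b \<otimes>\<^bsub>G2\<^esub> \<one>\<^bsub>G2\<^esub> \<otimes>\<^bsub>G2\<^esub> inv\<^bsub>G2\<^esub> b) \<in> L"
      using that(2) subgroup_DirProd_closed(4,5) by (simp add: goursat_K1_def)
    then show ?thesis using subgroup_DirProd_closed(2)[OF xb] by (simp add: goursat_K1_def)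
  qed
  ultimately show ?thesis unfolding P.normal_inv_iff by (simp add: inv)
qed

lemma subgroup_converse: "subgroup (L\<inverse>) (G2 \<times>\<times> G1)"
proof -
  have "prod.swap \<in> hom (G1 \<times>\<times> G2) (G2 \<times>\<times> G1)" by (auto simp: hom_def)
  then have "group_hom (G1 \<times>\<times> G2) (G2 \<times>\<times> G1) prod.swap"
    by (intro group_hom.intro group_DirProd DirProd_group G1.is_group G2.is_group group_hom_axioms.intro)
  moreover have "L\<inverse> = prod.swap ` L" by force
  ultimately show ?thesis using group_hom.subgroup_img_is_subgroup[OF _ L] by metis
qed

end

lemma goursat_P2_converse: "goursat_P2 L = goursat_P1 (L\<inverse>)"
  by (force simp: goursat_P1_def goursat_P2_def)

lemma goursat_K2_converse: "goursat_K2 G1 L = goursat_K1 G1 (L\<inverse>)"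
  by (simp add: goursat_K1_def goursat_K2_def)

text \<open>The criterion for canonical isomorphisms is applied to both factors, to the second
  through the converse relations. Its monotonicity conditions on the sections follow from
  \<open>L' \<subseteq> L\<close>.\<close>

lemma le_PK_iff:
  assumes L: "subgroup L (G1 \<times>\<times> G2)" and L': "subgroup L' (G1 \<times>\<times> G2)"
  shows "le_PK G1 G2 L' L \<longleftrightarrow> L' \<subseteq> L \<and>
    goursat_P1 L' \<inter> goursat_K1 G2 L \<subseteq> goursat_K1 G2 L' \<and>
    goursat_P1 L \<subseteq> goursat_K1 G2 L <#>\<^bsub>G1\<^esub> goursat_P1 L' \<and>
    goursat_P2 L' \<inter> goursat_K2 G1 L \<subseteq> goursat_K2 G1 L' \<and>
    goursat_P2 L \<subseteq> goursat_K2 G1 L <#>\<^bsub>G2\<^esub> goursat_P2 L'"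
proof -
  interpret swap: group_pair G2 G1 by unfold_locales
  have mono: "goursat_P1 L' \<subseteq> goursat_P1 L" "goursat_K1 G2 L' \<subseteq> goursat_K1 G2 L"
    "goursat_P1 (L'\<inverse>) \<subseteq> goursat_P1 (L\<inverse>)" "goursat_K1 G1 (L'\<inverse>) \<subseteq> goursat_K1 G1 (L\<inverse>)"
    if "L' \<subseteq> L"
    using that by (auto simp: goursat_P1_def goursat_K1_def)
  show ?thesis
    unfolding le_PK_def goursat_P2_converse goursat_K2_converse
    using G1.canonical_hom_is_iso_iff[OF subgroup_goursat_P1[OF L] subgroup_goursat_P1[OF L']
        mono(1,2) goursat_K1_normal[OF L] goursat_K1_normal[OF L']]
      G2.canonical_hom_is_iso_iff[OF
        swap.subgroup_goursat_P1[OF subgroup_converse[OF L]]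
        swap.subgroup_goursat_P1[OF subgroup_converse[OF L']] mono(3,4)
        swap.goursat_K1_normal[OF subgroup_converse[OF L]]
        swap.goursat_K1_normal[OF subgroup_converse[OF L']]]
    by blast
qed

end

section \<open>Goursat data under conjugation\<close>

lemma (in group) conjugation_iso:
  assumes "g \<in> carrier G"
  shows "(\<lambda>a. g \<otimes> a \<otimes> inv g) \<in> iso G G"
proof -
  have "bij_betw (\<lambda>a. g \<otimes> a \<otimes> inv g) (carrier G) (carrier G)"
    using conjugation_is_bij[OF assms] by (simp add: bij_betw_def cong: inj_on_cong)
  moreover have "g \<otimes> (a \<otimes> b) \<otimes> inv g = (g \<otimes> a \<otimes> inv g) \<otimes> (g \<otimes> b \<otimes> inv g)"
    if "a \<in> carrier G" "b \<in> carrier G" for a b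
  proof -
    have "inv g \<otimes> (g \<otimes> (b \<otimes> inv g)) = b \<otimes> inv g"
      using that assms by (simp flip: m_assoc)
    then show ?thesis using that assms by (simp add: m_assoc)
  qed
  ultimately show ?thesis using assms by (auto simp: iso_def hom_def)
qed

text \<open>For the kernels, a pair of the image with a trivial coordinate has to come from a pair
  of \<open>L\<close> with a trivial coordinate; this is injectivity of \<open>f\<close> and
  \<open>h\<close> together with preservation of the identity.\<close>

lemma goursat_image:
  assumes "f \<in> iso G1 G1" "h \<in> iso G2 G2" "group G1" "group G2" "L \<subseteq> carrier (G1 \<times>\<times> G2)"
  shows "goursat_P1 (map_prod f h ` L) = f ` goursat_P1 L"
    and "goursat_P2 (map_prod f h ` L) = h ` goursat_P2 L"
    and "goursat_K1 G2 (map_prod f h ` L) = f ` goursat_K1 G2 L"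
    and "goursat_K2 G1 (map_prod f h ` L) = h ` goursat_K2 G1 L"
proof -
  have one: "f \<one>\<^bsub>G1\<^esub> = \<one>\<^bsub>G1\<^esub>" "h \<one>\<^bsub>G2\<^esub> = \<one>\<^bsub>G2\<^esub>"
    using assms by (auto simp: iso_def intro: hom_one)
  have inj: "inj_on f (carrier G1)" "inj_on h (carrier G2)"
    using assms by (auto simp: iso_def bij_betw_def)
  have "a = \<one>\<^bsub>G1\<^esub>" if "(a, b) \<in> L" "f a = \<one>\<^bsub>G1\<^esub>" for a b
    using that one inj_onD[OF inj(1), of a "\<one>\<^bsub>G1\<^esub>"] assms(3,5)
    by (auto simp: group.is_monoid monoid.one_closed)
  moreover have "b = \<one>\<^bsub>G2\<^esub>" if "(a, b) \<in> L" "h b = \<one>\<^bsub>G2\<^esub>" for a b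
    using that one inj_onD[OF inj(2), of b "\<one>\<^bsub>G2\<^esub>"] assms(4,5)
    by (auto simp: group.is_monoid monoid.one_closed)
  ultimately show "goursat_K1 G2 (map_prod f h ` L) = f ` goursat_K1 G2 L"
      "goursat_K2 G1 (map_prod f h ` L) = h ` goursat_K2 G1 L"
    using one by (force simp: goursat_K1_def goursat_K2_def)+
qed (force simp: goursat_P1_def goursat_P2_def)+

context group_pair
begin

text \<open>Conjugation by a pair acts coordinatewise. The maps \<open>f\<close> and
  \<open>h\<close> are chosen independently of \<open>L\<close>, so both members of a related pair
  of subgroups are transported by the same maps.\<close>

lemma subgroup_conj_eq_image:
  assumes "g \<in> carrier (G1 \<times>\<times> G2)"
  obtains f h where "f \<in> iso G1 G1" "h \<in> iso G2 G2"
    "\<And>L. subgroup L (G1 \<times>\<times> G2) \<Longrightarrow> subgroup_conj (G1 \<times>\<times> G2) g L = map_prod f h ` L"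
proof -
  obtain g1 g2 where g: "g = (g1, g2)" "g1 \<in> carrier G1" "g2 \<in> carrier G2"
    using assms by auto
  show ?thesis
  proof
    show "(\<lambda>a. g1 \<otimes>\<^bsub>G1\<^esub> a \<otimes>\<^bsub>G1\<^esub> inv\<^bsub>G1\<^esub> g1) \<in> iso G1 G1"
      "(\<lambda>b. g2 \<otimes>\<^bsub>G2\<^esub> b \<otimes>\<^bsub>G2\<^esub> inv\<^bsub>G2\<^esub> g2) \<in> iso G2 G2"
      using g G1.conjugation_iso G2.conjugation_iso by auto
    show "subgroup_conj (G1 \<times>\<times> G2) g L = map_prod (\<lambda>a. g1 \<otimes>\<^bsub>G1\<^esub> a \<otimes>\<^bsub>G1\<^esub> inv\<^bsub>G1\<^esub> g1)
        (\<lambda>b. g2 \<otimes>\<^bsub>G2\<^esub> b \<otimes>\<^bsub>G2\<^esub> inv\<^bsub>G2\<^esub> g2) ` L" if "subgroup L (G1 \<times>\<times> G2)" for L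
      using that inv_DirProd[OF G1.is_group G2.is_group g(2,3)]
      by (force simp: g(1) subgroup_conj_def subgroups_of_def l_coset_def r_coset_def)
  qed
qed

lemma subgroup_carriers:
  assumes "subgroup L (G1 \<times>\<times> G2)"
  shows "goursat_P1 L \<subseteq> carrier G1" "goursat_P2 L \<subseteq> carrier G2"
    "goursat_K1 G2 L \<subseteq> carrier G1" "goursat_K2 G1 L \<subseteq> carrier G2"
  using subgroup.subset[OF assms]
  by (auto simp: goursat_P1_def goursat_P2_def goursat_K1_def goursat_K2_def)

lemma le_K_conj:
  assumes "g \<in> carrier (G1 \<times>\<times> G2)" "subgroup L (G1 \<times>\<times> G2)" "subgroup L' (G1 \<times>\<times> G2)"
    and "le_K G1 G2 L' L"
  shows "le_K G1 G2 (subgroup_conj (G1 \<times>\<times> G2) g L') (subgroup_conj (G1 \<times>\<times> G2) g L)"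
proof -
  obtain f h where fh: "f \<in> iso G1 G1" "h \<in> iso G2 G2"
    "\<And>L. subgroup L (G1 \<times>\<times> G2) \<Longrightarrow> subgroup_conj (G1 \<times>\<times> G2) g L = map_prod f h ` L"
    using subgroup_conj_eq_image[OF assms(1)] by blast
  note im = goursat_image[OF fh(1,2) G1.is_group G2.is_group subgroup.subset]
  show ?thesis
    using assms(4) by (auto simp: le_K_def fh(3) im assms(2,3))
qed

text \<open>In the form of inclusions, the relation involves only intersections and set products of
  subsets of the carriers. Injective homomorphisms commute with both operations, and taking images
  is monotone.\<close>

lemma le_PK_conj:
  assumes g: "g \<in> carrier (G1 \<times>\<times> G2)"
    and L: "subgroup L (G1 \<times>\<times> G2)" and L': "subgroup L' (G1 \<times>\<times> G2)"
    and le: "le_PK G1 G2 L' L"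
  shows "le_PK G1 G2 (subgroup_conj (G1 \<times>\<times> G2) g L') (subgroup_conj (G1 \<times>\<times> G2) g L)"
proof -
  interpret G: group "G1 \<times>\<times> G2" by (rule group_DirProd)
  interpret conj: group_action "G1 \<times>\<times> G2" "subgroups_of (G1 \<times>\<times> G2)" "subgroup_conj (G1 \<times>\<times> G2)"
    by (rule G.subgroup_conj_action)
  have sub: "subgroup (subgroup_conj (G1 \<times>\<times> G2) g M) (G1 \<times>\<times> G2)" if "subgroup M (G1 \<times>\<times> G2)" for M
    using conj.element_image[OF g] that by (auto simp: subgroups_of_def)
  obtain f h where fh: "f \<in> iso G1 G1" "h \<in> iso G2 G2"
    "\<And>L. subgroup L (G1 \<times>\<times> G2) \<Longrightarrow> subgroup_conj (G1 \<times>\<times> G2) g L = map_prod f h ` L"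
    using subgroup_conj_eq_image[OF g] by blast
  have inj: "inj_on f (carrier G1)" "inj_on h (carrier G2)"
    and hom: "f \<in> hom G1 G1" "h \<in> hom G2 G2"
    using fh(1,2) by (auto simp: iso_def bij_betw_def)
  note im = goursat_image[OF fh(1,2) G1.is_group G2.is_group subgroup.subset]
  note car = subgroup_carriers[OF L] subgroup_carriers[OF L']
  show ?thesis
    unfolding le_PK_iff[OF sub[OF L] sub[OF L']]
    unfolding fh(3)[OF L] fh(3)[OF L'] im[OF L] im[OF L']
      set_mult_hom[OF hom(1) car(3,5), symmetric] set_mult_hom[OF hom(2) car(4,6), symmetric]
      inj_on_image_Int[OF inj(1) car(5,3), symmetric] inj_on_image_Int[OF inj(2) car(6,4), symmetric]
    using le unfolding le_PK_iff[OF L L'] by (intro conjI image_mono) auto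
qed

section \<open>Unique refinement of an inclusion by a chain of the three relations\<close>

lemma goursat_chain_unique:
  assumes L: "subgroup L (G1 \<times>\<times> G2)" and L': "subgroup L' (G1 \<times>\<times> G2)"
    and Y: "subgroup Y (G1 \<times>\<times> G2)" and Z: "subgroup Z (G1 \<times>\<times> G2)"
    and le: "le_P L' Z" "le_PK G1 G2 Z Y" "le_K G1 G2 Y L"
  shows "Z = L \<inter> goursat_P1 L' \<times> goursat_P2 L'"
    and "Y = (goursat_K1 G2 L \<times> goursat_K2 G1 L) <#>\<^bsub>G1 \<times>\<times> G2\<^esub> L'"
proof -
  have P: "L' \<subseteq> Z" "goursat_P1 Z = goursat_P1 L'" "goursat_P2 Z = goursat_P2 L'"
    and K: "Y \<subseteq> L" "goursat_K1 G2 Y = goursat_K1 G2 L" "goursat_K2 G1 Y = goursat_K2 G1 L"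
    using le(1,3) by (auto simp: le_P_def le_K_def)
  have PK: "Z \<subseteq> Y" "goursat_P2 Z \<inter> goursat_K2 G1 Y \<subseteq> goursat_K2 G1 Z"
      "goursat_P1 Y \<subseteq> goursat_K1 G2 Y <#>\<^bsub>G1\<^esub> goursat_P1 Z"
    using le(2) unfolding le_PK_iff[OF Y Z] by auto
  note cY = subgroup_DirProd_closed[OF Y] and cZ = subgroup_DirProd_closed[OF Z]
    and cL = subgroup_DirProd_closed[OF L]
  show "Z = L \<inter> goursat_P1 L' \<times> goursat_P2 L'"
  proof (intro equalityI subrelI)
    fix a b assume "(a, b) \<in> Z"
    then show "(a, b) \<in> L \<inter> goursat_P1 L' \<times> goursat_P2 L'"
      using PK(1) K(1) unfolding P(2,3)[symmetric]
      by (force simp: goursat_P1_def goursat_P2_def)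
  next
    \<comment> \<open>Membership in the projections of \<open>Z\<close> supplies
      \<open>(a, b')\<close> and \<open>(a', b)\<close> in \<open>Z\<close>. The quotient of
      \<open>b\<close> by \<open>b'\<close> lies in \<open>K2\<close> of \<open>L\<close>, which is
      \<open>K2\<close> of \<open>Y\<close>, and in \<open>P2\<close> of \<open>Z\<close>, hence in
      \<open>K2\<close> of \<open>Z\<close>; multiplying \<open>(a, b')\<close> by it gives
      \<open>(a, b)\<close>.\<close>
    fix a b assume "(a, b) \<in> L \<inter> goursat_P1 L' \<times> goursat_P2 L'"
    then have ab: "(a, b) \<in> L" "a \<in> goursat_P1 Z" "b \<in> goursat_P2 Z" by (auto simp: P)
    then obtain b' a' where b': "(a, b') \<in> Z" and a': "(a', b) \<in> Z"
      by (auto simp: goursat_P1_def goursat_P2_def)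
    let ?k = "b \<otimes>\<^bsub>G2\<^esub> inv\<^bsub>G2\<^esub> b'"
    have "?k \<in> goursat_K2 G1 Y"
      using same_fst_imp_K2[OF L ab(1), of b'] b' PK(1) K by auto
    moreover have "?k \<in> goursat_P2 Z"
      using cZ(4)[OF a' cZ(5)[OF b']] by (force simp: goursat_P2_def)
    ultimately have "(\<one>\<^bsub>G1\<^esub>, ?k) \<in> Z" using PK(2) by (auto simp: goursat_K2_def)
    from cZ(4)[OF this b'] show "(a, b) \<in> Z"
      using cZ(1,2)[OF b'] cZ(2)[OF a'] by (simp add: G2.m_assoc)
  qed
  show "Y = (goursat_K1 G2 L \<times> goursat_K2 G1 L) <#>\<^bsub>G1 \<times>\<times> G2\<^esub> L'"
  proof (intro equalityI subrelI)
    \<comment> \<open>Surjectivity in the first factor splits \<open>a\<close> as \<open>k\<close>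
      times \<open>q\<close> with \<open>q\<close> in the projection of \<open>L'\<close>. Lifting
      \<open>q\<close> to \<open>(q, b')\<close> in \<open>L'\<close> puts \<open>(a, b')\<close>
      into \<open>Y\<close>, so \<open>b\<close> and \<open>b'\<close> differ by an element of
      \<open>K2\<close>.\<close>
    fix a b assume ab: "(a, b) \<in> Y"
    then have "a \<in> goursat_P1 Y" by (force simp: goursat_P1_def)
    then obtain k q where kq: "k \<in> goursat_K1 G2 Y" "q \<in> goursat_P1 L'" "a = k \<otimes>\<^bsub>G1\<^esub> q"
      using PK(3) by (auto simp: set_mult_def P)
    then obtain b' where b': "(q, b') \<in> L'" by (auto simp: goursat_P1_def)
    then have "(q, b') \<in> Y" using P(1) PK(1) by blast
    moreover have "(k, \<one>\<^bsub>G2\<^esub>) \<in> Y" using kq(1) by (simp add: goursat_K1_def)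
    ultimately have "(a, b') \<in> Y" using cY(2,4) kq(3) by fastforce
    then have "b \<otimes>\<^bsub>G2\<^esub> inv\<^bsub>G2\<^esub> b' \<in> goursat_K2 G1 L"
      using same_fst_imp_K2[OF Y ab] K(3) by simp
    moreover have "(a, b) = (k, b \<otimes>\<^bsub>G2\<^esub> inv\<^bsub>G2\<^esub> b') \<otimes>\<^bsub>G1 \<times>\<times> G2\<^esub> (q, b')"
      using kq(3) cY(2)[OF ab] cY(2)[OF \<open>(a, b') \<in> Y\<close>] by (simp add: G2.m_assoc)
    ultimately show "(a, b) \<in> (goursat_K1 G2 L \<times> goursat_K2 G1 L) <#>\<^bsub>G1 \<times>\<times> G2\<^esub> L'"
      using kq(1) b' K(2) unfolding set_mult_def by blast
  next
    fix a b assume "(a, b) \<in> (goursat_K1 G2 L \<times> goursat_K2 G1 L) <#>\<^bsub>G1 \<times>\<times> G2\<^esub> L'"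
    then obtain k1 k2 p q where *: "k1 \<in> goursat_K1 G2 Y" "k2 \<in> goursat_K2 G1 Y" "(p, q) \<in> L'"
        "a = k1 \<otimes>\<^bsub>G1\<^esub> p" "b = k2 \<otimes>\<^bsub>G2\<^esub> q"
      by (auto simp: set_mult_def K)
    then have k: "(k1, \<one>\<^bsub>G2\<^esub>) \<in> Y" "(\<one>\<^bsub>G1\<^esub>, k2) \<in> Y" by (auto simp: goursat_K1_def goursat_K2_def)
    have "(p, q) \<in> Y" using *(3) P(1) PK(1) by blast
    with cY(4)[OF cY(4)[OF k] this] show "(a, b) \<in> Y"
      using *(4,5) cY(1)[OF k(1)] cY(2)[OF k(2)] by simp
  qed
qed

text \<open>Conjugation by an element of \<open>L\<close> acts on the coordinates through elements
  of \<open>P1\<close> and \<open>P2\<close>, which normalize \<open>K1\<close> and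
  \<open>K2\<close>. Normality is what makes the product of \<open>K1 \<times> K2\<close> with a
  subgroup of \<open>L\<close> again a subgroup.\<close>

lemma goursat_kernels_normal:
  assumes L: "subgroup L (G1 \<times>\<times> G2)"
  shows "goursat_K1 G2 L \<times> goursat_K2 G1 L \<lhd> (G1 \<times>\<times> G2)\<lparr>carrier := L\<rparr>"
proof -
  interpret swap: group_pair G2 G1 by unfold_locales
  interpret G: group "G1 \<times>\<times> G2" by (rule group_DirProd)
  interpret L: group "(G1 \<times>\<times> G2)\<lparr>carrier := L\<rparr>" by (rule G.subgroup_imp_group[OF L])
  let ?K1 = "goursat_K1 G2 L" and ?K2 = "goursat_K2 G1 L"
  interpret K1: normal ?K1 "G1\<lparr>carrier := goursat_P1 L\<rparr>" by (rule goursat_K1_normal[OF L])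
  interpret K2: normal ?K2 "G2\<lparr>carrier := goursat_P2 L\<rparr>"
    unfolding goursat_K2_converse goursat_P2_converse
    by (rule swap.goursat_K1_normal[OF subgroup_converse[OF L]])
  have P2: "subgroup (goursat_P2 L) G2"
    unfolding goursat_P2_converse by (rule swap.subgroup_goursat_P1[OF subgroup_converse[OF L]])
  have "subgroup (?K1 \<times> ?K2) (G1 \<times>\<times> G2)"
    using DirProd_subgroups[OF G1.is_group _ G2.is_group]
      G1.incl_subgroup[OF subgroup_goursat_P1[OF L] K1.subgroup_axioms]
      G2.incl_subgroup[OF P2 K2.subgroup_axioms] by blast
  moreover have "?K1 \<times> ?K2 \<subseteq> L"
  proof (intro subrelI)
    fix a b assume "(a, b) \<in> ?K1 \<times> ?K2"
    then have k: "(a, \<one>\<^bsub>G2\<^esub>) \<in> L" "(\<one>\<^bsub>G1\<^esub>, b) \<in> L" by (auto simp: goursat_K1_def goursat_K2_def)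
    show "(a, b) \<in> L"
      using subgroup_DirProd_closed(4)[OF L k]
        subgroup_DirProd_closed(1)[OF L k(1)] subgroup_DirProd_closed(2)[OF L k(2)] by simp
  qed
  ultimately have "subgroup (?K1 \<times> ?K2) ((G1 \<times>\<times> G2)\<lparr>carrier := L\<rparr>)"
    by (rule G.subgroup_incl[OF _ L])
  moreover have "x \<otimes>\<^bsub>G1 \<times>\<times> G2\<^esub> h \<otimes>\<^bsub>G1 \<times>\<times> G2\<^esub> inv\<^bsub>G1 \<times>\<times> G2\<^esub> x \<in> ?K1 \<times> ?K2"
    if x: "x \<in> L" and h: "h \<in> ?K1 \<times> ?K2" for x h
  proof -
    obtain a b k1 k2 where eq: "x = (a, b)" "h = (k1, k2)" by fastforce
    with x have ab: "a \<in> goursat_P1 L" "b \<in> goursat_P2 L" by (force simp: goursat_P1_def goursat_P2_def)+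
    have "a \<otimes>\<^bsub>G1\<^esub> k1 \<otimes>\<^bsub>G1\<^esub> inv\<^bsub>G1\<^esub> a \<in> ?K1"
      using K1.inv_op_closed2[of a k1] ab h eq
      by (simp add: G1.m_inv_consistent[OF subgroup_goursat_P1[OF L]])
    moreover have "b \<otimes>\<^bsub>G2\<^esub> k2 \<otimes>\<^bsub>G2\<^esub> inv\<^bsub>G2\<^esub> b \<in> ?K2"
      using K2.inv_op_closed2[of b k2] ab h eq by (simp add: G2.m_inv_consistent[OF P2])
    ultimately show ?thesis
      using eq subgroup_DirProd_closed(1,2)[OF L, of a b] x
      by (simp add: inv_DirProd[OF G1.is_group G2.is_group])
  qed
  ultimately show ?thesis
    unfolding L.normal_inv_iff by (simp add: G.m_inv_consistent[OF L])
qed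

text \<open>The outer links are sandwiches:
  \<open>L' \<subseteq> Z \<subseteq> P1' \<times> P2'\<close> forces the projections of
  \<open>Z\<close>, and \<open>K1 \<times> K2 \<subseteq> Y \<subseteq> L\<close> forces the kernels
  of \<open>Y\<close>. The middle link is then checked through its inclusions.\<close>

lemma goursat_chain_exists:
  fixes L L' :: "('a \<times> 'b) set"
  defines "Z \<equiv> L \<inter> goursat_P1 L' \<times> goursat_P2 L'"
    and "Y \<equiv> (goursat_K1 G2 L \<times> goursat_K2 G1 L) <#>\<^bsub>G1 \<times>\<times> G2\<^esub> L'"
  assumes L: "subgroup L (G1 \<times>\<times> G2)" and L': "subgroup L' (G1 \<times>\<times> G2)" and "L' \<subseteq> L"
  shows "subgroup Y (G1 \<times>\<times> G2)" "subgroup Z (G1 \<times>\<times> G2)"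
    and "le_P L' Z" "le_PK G1 G2 Z Y" "le_K G1 G2 Y L"
proof -
  interpret swap: group_pair G2 G1 by unfold_locales
  interpret G: group "G1 \<times>\<times> G2" by (rule group_DirProd)
  note cL = subgroup_DirProd_closed[OF L] and cL' = subgroup_DirProd_closed[OF L']
  have YL: "subgroup Y ((G1 \<times>\<times> G2)\<lparr>carrier := L\<rparr>)"
    unfolding Y_def
    by (rule G.mult_norm_sub_in_sub[OF goursat_kernels_normal[OF L]
          G.subgroup_incl[OF L' L \<open>L' \<subseteq> L\<close>] L])
  then show Y: "subgroup Y (G1 \<times>\<times> G2)" by (rule G.incl_subgroup[OF L])
  have "Y \<subseteq> L" using subgroup.subset[OF YL] by simp
  have "subgroup (goursat_P1 L' \<times> goursat_P2 L') (G1 \<times>\<times> G2)"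
    unfolding goursat_P2_converse
    using DirProd_subgroups[OF G1.is_group subgroup_goursat_P1[OF L'] G2.is_group
        swap.subgroup_goursat_P1[OF subgroup_converse[OF L']]] .
  then show Z: "subgroup Z (G1 \<times>\<times> G2)"
    unfolding Z_def by (rule G.subgroups_Inter_pair[OF L])
  show "le_P L' Z"
    using \<open>L' \<subseteq> L\<close> by (force simp: le_P_def Z_def goursat_P1_def goursat_P2_def)
  then have PZ: "goursat_P1 Z = goursat_P1 L'" "goursat_P2 Z = goursat_P2 L'"
    by (auto simp: le_P_def)
  have memY: "(k1 \<otimes>\<^bsub>G1\<^esub> a, k2 \<otimes>\<^bsub>G2\<^esub> b) \<in> Y"
    if "(k1, \<one>\<^bsub>G2\<^esub>) \<in> L" "(\<one>\<^bsub>G1\<^esub>, k2) \<in> L" "(a, b) \<in> L'" for k1 k2 a b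
    unfolding Y_def set_mult_def using that
    by (force simp: goursat_K1_def goursat_K2_def intro!: bexI[of _ "(k1, k2)"] bexI[of _ "(a, b)"])
  have KY: "goursat_K1 G2 Y = goursat_K1 G2 L" "goursat_K2 G1 Y = goursat_K2 G1 L"
    using memY[OF _ cL(3) cL'(3)] memY[OF cL(3) _ cL'(3)] \<open>Y \<subseteq> L\<close> cL(1,2)
    by (fastforce simp: goursat_K1_def goursat_K2_def)+
  with \<open>Y \<subseteq> L\<close> show "le_K G1 G2 Y L" by (simp add: le_K_def)
  show "le_PK G1 G2 Z Y"
    unfolding le_PK_iff[OF Y Z] PZ KY
  proof (intro conjI)
    show "Z \<subseteq> Y"
    proof (intro subrelI)
      \<comment> \<open>Some \<open>(a, b')\<close> lies in \<open>L'\<close>, and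
        \<open>(a, b)\<close> is its product with the element of \<open>\<one> \<times> K2\<close>
        obtained by dividing \<open>b\<close> by \<open>b'\<close>.\<close>
      fix a b assume "(a, b) \<in> Z"
      then obtain b' where ab: "(a, b) \<in> L" "(a, b') \<in> L'" by (auto simp: Z_def goursat_P1_def)
      then have "(\<one>\<^bsub>G1\<^esub>, b \<otimes>\<^bsub>G2\<^esub> inv\<^bsub>G2\<^esub> b') \<in> L"
        using same_fst_imp_K2[OF L ab(1)] \<open>L' \<subseteq> L\<close> by (auto simp: goursat_K2_def)
      from memY[OF cL(3) this ab(2)] show "(a, b) \<in> Y"
        using cL(1,2)[OF ab(1)] cL'(2)[OF ab(2)] by (simp add: G2.m_assoc)
    qed
    \<comment> \<open>For \<open>a\<close> in both \<open>P1'\<close> and \<open>K1\<close>, the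
      pair \<open>(a, \<one>)\<close> lies in \<open>L\<close>; it lies in \<open>Z\<close> because
      the identity belongs to \<open>P2'\<close>. The other factor is symmetric.\<close>
    have one: "\<one>\<^bsub>G1\<^esub> \<in> goursat_P1 L'" "\<one>\<^bsub>G2\<^esub> \<in> goursat_P2 L'"
      using cL'(3) by (force simp: goursat_P1_def goursat_P2_def)+
    show "goursat_P1 L' \<inter> goursat_K1 G2 L \<subseteq> goursat_K1 G2 Z"
      "goursat_P2 L' \<inter> goursat_K2 G1 L \<subseteq> goursat_K2 G1 Z"
      using one by (auto simp: Z_def goursat_K1_def goursat_K2_def)
    show "goursat_P1 Y \<subseteq> goursat_K1 G2 L <#>\<^bsub>G1\<^esub> goursat_P1 L'"
      "goursat_P2 Y \<subseteq> goursat_K2 G1 L <#>\<^bsub>G2\<^esub> goursat_P2 L'"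
      by (force simp: Y_def set_mult_def goursat_P1_def goursat_P2_def)+
  qed
qed

text \<open>Each summand is the indicator of a chain, and the chain is unique and exists exactly for
  an inclusion. The nesting of the sums is the one produced by two uses of
  \<open>weighted_incidence_mult\<close>.\<close>

lemma goursat_chain_count:
  assumes "finite (subgroups_of (G1 \<times>\<times> G2))"
    and "subgroup L (G1 \<times>\<times> G2)" "subgroup L' (G1 \<times>\<times> G2)"
  shows "(\<Sum>Y\<in>subgroups_of (G1 \<times>\<times> G2). (\<Sum>Z\<in>subgroups_of (G1 \<times>\<times> G2).
      of_bool (le_P L' Z) * of_bool (le_PK G1 G2 Z Y)) * of_bool (le_K G1 G2 Y L)) =
    (of_bool (L' \<subseteq> L) :: nat)"
proof -
  let ?S = "subgroups_of (G1 \<times>\<times> G2)"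
  let ?Z = "L \<inter> goursat_P1 L' \<times> goursat_P2 L'"
  let ?Y = "(goursat_K1 G2 L \<times> goursat_K2 G1 L) <#>\<^bsub>G1 \<times>\<times> G2\<^esub> L'"
  have iff: "le_P L' Z \<and> le_PK G1 G2 Z Y \<and> le_K G1 G2 Y L \<longleftrightarrow> Y = ?Y \<and> Z = ?Z \<and> L' \<subseteq> L"
    if "Y \<in> ?S" "Z \<in> ?S" for Y Z
  proof
    assume *: "le_P L' Z \<and> le_PK G1 G2 Z Y \<and> le_K G1 G2 Y L"
    then have "L' \<subseteq> L" by (auto simp: le_P_def le_PK_def le_K_def)
    with * goursat_chain_unique[OF assms(2,3), of Y Z] that show "Y = ?Y \<and> Z = ?Z \<and> L' \<subseteq> L"
      by (simp add: subgroups_of_def)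
  qed (use goursat_chain_exists[OF assms(2,3)] in blast)
  have "(\<Sum>Y\<in>?S. (\<Sum>Z\<in>?S. of_bool (le_P L' Z) * of_bool (le_PK G1 G2 Z Y)) * of_bool (le_K G1 G2 Y L)) =
      (\<Sum>Y\<in>?S. \<Sum>Z\<in>?S. of_bool (le_P L' Z \<and> le_PK G1 G2 Z Y \<and> le_K G1 G2 Y L) :: nat)"
    unfolding sum_distrib_right by (intro sum.cong) auto
  \<comment> \<open>One conditional per summation index, so that each of the two sums collapses as a
    delta sum.\<close>
  also have "\<dots> = (\<Sum>Y\<in>?S. \<Sum>Z\<in>?S. if Y = ?Y then if Z = ?Z then of_bool (L' \<subseteq> L) else 0 else 0)"
    by (intro sum.cong refl) (simp only: iff, simp)
  also have "\<dots> = (\<Sum>Y\<in>?S. if Y = ?Y then \<Sum>Z\<in>?S. if Z = ?Z then of_bool (L' \<subseteq> L) else 0 else 0)"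
    by (intro sum.cong) auto
  also have "\<dots> = of_bool (L' \<subseteq> L)"
    \<comment> \<open>If \<open>L' \<subseteq> L\<close>, then \<open>?Y\<close> and
      \<open>?Z\<close> are subgroups and so occur as summation indices; otherwise every term is
      0.\<close>
    using goursat_chain_exists(1,2)[OF assms(2,3)] assms(1)
    by (auto simp: sum.delta subgroups_of_def)
  finally show ?thesis .
qed

end

section \<open>Assembly of chain counts and marks into a matrix identity\<close>

theorem theorem6p1:
  fixes G1 :: "('a, 'm) monoid_scheme" and G2 :: "('b, 'n) monoid_scheme"
    and T :: "('a \<times> 'b) set list"
  assumes "group G1" and "finite (carrier G1)"
    and "group G2" and "finite (carrier G2)"
    and "orbit_transversal (G1 \<times>\<times> G2) (subgroups_of (G1 \<times>\<times> G2)) (subgroup_conj (G1 \<times>\<times> G2)) T"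
  shows "table_of_marks (G1 \<times>\<times> G2) T =
    normalizer_index_matrix (G1 \<times>\<times> G2) T
      * subgroup_class_incidence (G1 \<times>\<times> G2) (le_K G1 G2) T
      * subgroup_class_incidence (G1 \<times>\<times> G2) (le_PK G1 G2) T
      * subgroup_class_incidence (G1 \<times>\<times> G2) le_P T"
proof -
  interpret group_pair G1 G2 using assms(1,3) by (rule group_pair.intro)
  let ?G = "G1 \<times>\<times> G2"
  let ?S = "subgroups_of ?G" and ?c = "subgroup_conj ?G" and ?n = "length T"
  interpret G: group ?G by (rule group_DirProd)
  interpret conj: group_action ?G ?S ?c by (rule G.subgroup_conj_action)
  have fin: "finite (carrier ?G)" using assms(2,4) by simp
  have finS: "finite ?S"
    by (rule finite_subset[of _ "Pow (carrier ?G)"])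
      (use fin subgroup.subset[of _ ?G] in \<open>auto simp: subgroups_of_def\<close>)
  have TS: "T ! i \<in> ?S" if "i < ?n" for i
    using assms(5) that nth_mem by (fastforce simp: orbit_transversal_def)
  let ?W = "\<lambda>R. weighted_incidence ?G ?c (\<lambda>x y. of_bool (R x y)) T"
  let ?D = "normalizer_index_matrix ?G T"
  have A: "subgroup_class_incidence ?G R T = ?W R" for R
    unfolding subgroup_class_incidence_def
    by (rule conj.class_incidence_matrix_eq_weighted[OF assms(5) finS])
  have D: "?D \<in> carrier_mat ?n ?n" by (simp add: normalizer_index_matrix_def)
  have inv_K: "le_K G1 G2 (?c g x) (?c g y) \<longleftrightarrow> le_K G1 G2 x y"
    if "g \<in> carrier ?G" "x \<in> ?S" "y \<in> ?S" for g x y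
    by (rule conj.invariant_relation_iff[OF _ that]) (simp add: le_K_conj subgroups_of_def)
  have inv_PK: "le_PK G1 G2 (?c g x) (?c g y) \<longleftrightarrow> le_PK G1 G2 x y"
    if "g \<in> carrier ?G" "x \<in> ?S" "y \<in> ?S" for g x y
    by (rule conj.invariant_relation_iff[OF _ that]) (simp add: le_PK_conj subgroups_of_def)
  \<comment> \<open>With the product bracketed to the right, the left factor is each time the matrix
    of a single relation whose invariance is established above.\<close>
  have "?W (le_K G1 G2) * (?W (le_PK G1 G2) * ?W le_P) =
      weighted_incidence ?G ?c (\<lambda>x z. \<Sum>Y\<in>?S. (\<Sum>Z\<in>?S.
        of_bool (le_P x Z) * of_bool (le_PK G1 G2 Z Y)) * of_bool (le_K G1 G2 Y z)) T"
    using conj.weighted_incidence_mult[OF assms(5) finS] inv_K inv_PK by simp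
  also have "\<dots> = ?W (\<subseteq>)"
    unfolding weighted_incidence_def
  proof (intro cong_mat refl, unfold prod.case, intro sum.cong refl)
    fix i j L assume "i < ?n" "j < ?n" "L \<in> orbit ?G ?c (T ! i)"
    then have "L \<in> ?S" "T ! j \<in> ?S" using TS conj.orbit_subset by blast+
    then show "(\<Sum>Y\<in>?S. (\<Sum>Z\<in>?S. of_bool (le_P (T ! j) Z) * of_bool (le_PK G1 G2 Z Y)) *
        of_bool (le_K G1 G2 Y L)) = (of_bool (T ! j \<subseteq> L) :: nat)"
      using goursat_chain_count[OF finS] by (simp add: subgroups_of_def)
  qed
  finally have chain: "?W (le_K G1 G2) * (?W (le_PK G1 G2) * ?W le_P) = ?W (\<subseteq>)" .
  have "?D * ?W (le_K G1 G2) * ?W (le_PK G1 G2) * ?W le_P = ?D * ?W (\<subseteq>)"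
    unfolding chain[symmetric]
    using assoc_mult_mat[OF mult_carrier_mat[OF D weighted_incidence_carrier]
        weighted_incidence_carrier weighted_incidence_carrier]
      assoc_mult_mat[OF D weighted_incidence_carrier
        mult_carrier_mat[OF weighted_incidence_carrier weighted_incidence_carrier]]
    by metis
  also have "\<dots> = table_of_marks ?G T"
  proof (rule eq_matI)
    fix i j assume "i < dim_row (table_of_marks ?G T)" "j < dim_col (table_of_marks ?G T)"
    then have ij: "i < ?n" "j < ?n" by (auto simp: table_of_marks_def)
    let ?O = "orbit ?G ?c (T ! i)"
    have finO: "finite ?O" using conj.orbit_subset[OF TS[OF ij(1)]] finS by (rule finite_subset)
    \<comment> \<open>A diagonal matrix on the left scales rows, so the normalizer index is that of
      \<open>T ! i\<close>, the subgroup whose cosets are permuted.\<close>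
    have "(?D * ?W (\<subseteq>)) $$ (i, j) =
        subgroup_index ?G (normalizer ?G (T ! i)) (T ! i) * ?W (\<subseteq>) $$ (i, j)"
      unfolding normalizer_index_matrix_def
      by (subst mat_diag_mult_left[OF weighted_incidence_carrier]) (use ij in simp)
    also have "?W (\<subseteq>) $$ (i, j) = card {H \<in> ?O. T ! j \<subseteq> H}"
      using ij finO by (simp add: weighted_incidence_def sum_of_bool_eq Int_def)
    also have "subgroup_index ?G (normalizer ?G (T ! i)) (T ! i) * \<dots> =
        table_of_marks ?G T $$ (i, j)"
      using ij TS[OF ij(1)] TS[OF ij(2)] G.card_fixed_points_coset_action[OF fin]
      by (simp add: table_of_marks_def subgroups_of_def)
    finally show "(?D * ?W (\<subseteq>)) $$ (i, j) = table_of_marks ?G T $$ (i, j)" .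
  qed (use D in \<open>auto simp: table_of_marks_def weighted_incidence_def\<close>)
  finally show ?thesis unfolding A by simp
qed

end
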